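(* Let $r, k > 0$ be real and $N \in \mathbb{N}$. Let $\alpha^* := r\max_{x\in(0,\infty)} \mathcal{F}_{N,k}(x)$. Then, for every $\alpha \in (0,\alpha^* )$, the equation $$\frac{\alpha}{r} - \mathcal{F}_{N,k}(x) = 0$$ has exactly two solutions $x \ge 0$.
   Context: For $k>0$ and $N\in\mathbb{N}$, define for real $x \ge 0$ $$\mathcal{F}_{N,k}(x) := kx\left(1-\left(\frac{x}{x+1/k}\right)^{N+1}\right) - (N+1)\left(\frac{x}{x+1/k}\right)^{N+1}.$$ The unknown $x$ is a real number $x\ge 0$ (the equilibrium quartz concentration). (The equation is the one satisfied by the equilibrium value of $x$ in the system $\dot M_0 = r - k_0xM_0-(p_0+q_0)M_0$, $\dot M_i = k_{i-1}xM_{i-1}-k_ixM_i-(p_i+q_i)M_i$ for $i\ge1$, $\dot x = \alpha - x\sum_{i\ge 0} k_iM_i+\sum_{i\ge 0} i q_i M_i$, with $k_i=k$ for all $i$, $p_i=1,\ q_i=0$ for $i\le N$, and $p_i=0,\ q_i=1$ for $i\ge N+1$.) *)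

theory Defs
  imports Complex_Main
begin

definition F :: "nat \<Rightarrow> real \<Rightarrow> real \<Rightarrow> real" where
  "F N k x = k * x * (1 - (x / (x + 1 / k)) ^ (N + 1))
               - real (N + 1) * (x / (x + 1 / k)) ^ (N + 1)"

(* The maximum is taken over an infinite set, so Max does not apply. GREATEST is unspecified
   if no maximum exists; attainment therefore has to be asserted wherever this is used. *)
definition alpha_star :: "real \<Rightarrow> nat \<Rightarrow> real \<Rightarrow> real" where
  "alpha_star r N k = r * (GREATEST m. m \<in> F N k ` {0<..})"

end

theory Submission
  imports Defs
begin

text \<open>
  The substitution \<open>u = x / (x + 1/k)\<close> is a bijection from \<open>[0,\<infinity>)\<close> onto \<open>[0,1)\<close> with
  \<open>k x = u / (1 - u)\<close>. It removes \<open>k\<close> and, by the geometric sum, turns \<open>F N k\<close> into the polynomial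
  \<open>u + u\<^sup>2 + \<dots> + u^N - N u^(N+1)\<close>, which vanishes at both \<open>0\<close> and \<open>1\<close>. Divided by \<open>u^N\<close>, the
  derivative of this polynomial is a positive combination of negative powers of \<open>u\<close> minus a constant,
  hence strictly decreasing; for \<open>N > 0\<close> the derivative is positive at \<open>0\<close> and negative at \<open>1\<close>.
  So the polynomial increases strictly from \<open>0\<close> to its maximum and then decreases strictly back to \<open>0\<close>
  (\<open>profile_unimodal\<close>). The intermediate value theorem on each of the two branches gives exactly two
  solutions for every level strictly between \<open>0\<close> and the maximum (\<open>card_level_set_unimodal\<close>).

  For \<open>N = 0\<close> the function \<open>F N k\<close> vanishes identically on \<open>[0,\<infinity>)\<close>. The maximum is then \<open>0\<close>, attained
  everywhere, and the interval of admissible \<open>\<alpha>\<close> is empty.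
\<close>

lemma card_level_set_unimodal:
  fixes g :: "real \<Rightarrow> real"
  assumes "a \<le> m" "m \<le> b" and cont: "continuous_on {a..b} g"
    and inc: "strict_mono_on {a..m} g" and dec: "strict_antimono_on {m..b} g"
    and "g a < c" "g b < c" "c < g m"
  shows "card {u \<in> {a<..<b}. g u = c} = 2"
proof -
  have "\<exists>p\<ge>a. p \<le> m \<and> g p = c"
    using assms by (intro IVT') (auto intro: continuous_on_subset)
  then obtain p where p: "a \<le> p" "p \<le> m" "g p = c" by blast
  have "\<exists>q\<ge>m. q \<le> b \<and> g q = c"
    using assms by (intro IVT2') (auto intro: continuous_on_subset)
  then obtain q where q: "m \<le> q" "q \<le> b" "g q = c" by blast
  have "a < p" "p < m" "m < q" "q < b"
    using p q assms(6-8) by (auto simp: less_le)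
  moreover have "u = p \<or> u = q" if "u \<in> {a<..<b}" "g u = c" for u
  proof (cases "u \<le> m")
    case True
    with p that strict_mono_on_imp_inj_on[OF inc] show ?thesis
      by (auto dest!: inj_onD)
  next
    case False
    then have "\<not> u < q" "\<not> q < u"
      using that q monotone_onD[OF dec, of u q] monotone_onD[OF dec, of q u] by auto
    then show ?thesis by simp
  qed
  ultimately have "{u \<in> {a<..<b}. g u = c} = {p, q}" "p \<noteq> q"
    using p q by auto
  then show ?thesis by simp
qed

definition profile :: "nat \<Rightarrow> real \<Rightarrow> real" where
  "profile N u = (\<Sum>i<N. u ^ Suc i) - real N * u ^ Suc N"

definition profile_deriv :: "nat \<Rightarrow> real \<Rightarrow> real" where
  "profile_deriv N u = (\<Sum>i<N. real (Suc i) * u ^ i) - real N * (real (Suc N) * u ^ N)"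

lemma has_real_derivative_profile:
  "(profile N has_real_derivative profile_deriv N u) (at u)"
  unfolding profile_def profile_deriv_def
  by (intro DERIV_diff DERIV_sum DERIV_cmult) (auto intro!: derivative_eq_intros simp del: power_Suc)

lemma profile_0: "profile N 0 = 0" and profile_1: "profile N 1 = 0"
  by (simp_all add: profile_def)

text \<open>
  This is the strict decrease of \<open>profile_deriv N u / u^N\<close>, cleared of denominators: the subtracted
  terms cancel, and each remaining exponent \<open>i\<close> is smaller than \<open>N\<close>.
\<close>

lemma profile_deriv_ratio_decreasing:
  assumes "0 < N" "0 < s" "s < t"
  shows "profile_deriv N t * s ^ N < profile_deriv N s * t ^ N"
proof -
  have "(\<Sum>i<N. real (Suc i) * t ^ i * s ^ N) < (\<Sum>i<N. real (Suc i) * s ^ i * t ^ N)"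
  proof (rule sum_strict_mono)
    fix i assume "i \<in> {..<N}"
    then have i: "i < N" by simp
    then have split: "x ^ N = x ^ i * x ^ (N - i)" for x :: real
      by (simp flip: power_add)
    have "s ^ (N - i) < t ^ (N - i)"
      using assms i by (intro power_strict_mono) auto
    then have "real (Suc i) * (s ^ i * t ^ i) * s ^ (N - i) < real (Suc i) * (s ^ i * t ^ i) * t ^ (N - i)"
      using assms by (intro mult_strict_left_mono) auto
    then show "real (Suc i) * t ^ i * s ^ N < real (Suc i) * s ^ i * t ^ N"
      by (simp add: split mult_ac)
  qed (use assms in auto)
  then have "(\<Sum>i<N. real (Suc i) * t ^ i) * s ^ N < (\<Sum>i<N. real (Suc i) * s ^ i) * t ^ N"
    unfolding sum_distrib_right .
  then show ?thesis
    unfolding profile_deriv_def left_diff_distrib by (simp only: mult_ac)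
qed

lemma profile_unimodal:
  assumes "0 < N"
  obtains m where "0 < m" "m < 1"
    "strict_mono_on {0..m} (profile N)" "strict_antimono_on {m..1} (profile N)"
proof -
  have d0: "profile_deriv N 0 > 0"
    using assms by (cases N) (auto simp: profile_deriv_def sum.lessThan_Suc_shift)
  have "(\<Sum>i<N. real (Suc i)) \<le> real (card {..<N}) * real N"
    by (rule sum_bounded_above) auto
  then have d1: "profile_deriv N 1 < 0"
    using assms by (simp add: profile_deriv_def algebra_simps)
  have "\<exists>m\<ge>0. m \<le> 1 \<and> profile_deriv N m = 0"
    using d0 d1 by (intro IVT2') (auto simp: profile_deriv_def intro!: continuous_intros)
  then obtain m where "0 \<le> m" "m \<le> 1" and dm: "profile_deriv N m = 0" by blast
  with d0 d1 have m: "0 < m" "m < 1" by (auto simp: less_le)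
  have pos: "0 < profile_deriv N u" if "0 < u" "u < m" for u
    using profile_deriv_ratio_decreasing[OF assms that] dm m by (simp add: zero_less_mult_iff)
  have neg: "profile_deriv N u < 0" if "m < u" for u
    using profile_deriv_ratio_decreasing[OF assms m(1) that] dm m by (simp add: mult_less_0_iff)
  have cont: "continuous_on A (profile N)" for A
    unfolding profile_def by (intro continuous_intros)
  have "strict_mono_on {0..m} (profile N)"
    by (rule strict_mono_onI, rule DERIV_pos_imp_increasing_open)
       (use pos cont has_real_derivative_profile in force)+
  moreover have "strict_antimono_on {m..1} (profile N)"
    by (rule monotone_onI, rule DERIV_neg_imp_decreasing_open)
       (use neg cont has_real_derivative_profile in force)+
  ultimately show ?thesis using that m by blast
qed

definition saturation :: "real \<Rightarrow> real \<Rightarrow> real" where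
  "saturation k x = x / (x + 1 / k)"

lemma bij_betw_saturation:
  assumes "0 < k"
  shows "bij_betw (saturation k) {0<..} {0<..<1}"
proof -
  have eq: "saturation k x = 1 - 1 / (k * x + 1)" if "0 \<le> x" for x
  proof -
    have "0 < k * x + 1" using assms that by (simp add: add_nonneg_pos)
    then show ?thesis using assms by (simp add: saturation_def field_simps)
  qed
  show ?thesis
  proof (rule bij_betw_byWitness[where f' = "\<lambda>u. (1 / (1 - u) - 1) / k"])
    show "\<forall>x\<in>{0<..}. (1 / (1 - saturation k x) - 1) / k = x"
      using assms by (simp add: eq)
    show "\<forall>u\<in>{0<..<1}. saturation k ((1 / (1 - u) - 1) / k) = u"
      using assms by (simp add: eq)
    show "saturation k ` {0<..} \<subseteq> {0<..<1}"
      using assms by (auto simp: eq add_pos_pos)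
    show "(\<lambda>u. (1 / (1 - u) - 1) / k) ` {0<..<1} \<subseteq> {0<..}"
      using assms by auto
  qed
qed

lemma F_eq_profile:
  assumes "0 < k" "0 \<le> x"
  shows "F N k x = profile N (saturation k x)"
proof -
  define u where "u = saturation k x"
  have pos: "0 < k * x + 1" using assms by (simp add: add_nonneg_pos)
  have u: "u = k * x / (k * x + 1)"
    using assms pos by (simp add: u_def saturation_def field_simps)
  have kx: "k * x * (1 - u) = u"
    using pos by (simp add: u field_simps)
  have "k * x * (1 - u ^ Suc N) = k * x * ((1 - u) * (\<Sum>i<Suc N. u ^ i))"
    by (simp only: one_diff_power_eq)
  also have "\<dots> = u * (\<Sum>i<Suc N. u ^ i)"
    by (simp only: mult.assoc[symmetric] kx)
  also have "\<dots> = (\<Sum>i<N. u ^ Suc i) + u ^ Suc N"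
    by (simp add: sum_distrib_left algebra_simps)
  finally have "k * x * (1 - u ^ Suc N) = (\<Sum>i<N. u ^ Suc i) + u ^ Suc N" .
  moreover have "F N k x = k * x * (1 - u ^ Suc N) - (real N + 1) * u ^ Suc N"
    by (simp add: F_def u_def saturation_def add.commute)
  ultimately have "F N k x = profile N u"
    unfolding profile_def by (simp only: distrib_right mult_1_left)
  then show ?thesis by (simp only: u_def)
qed

text \<open>
  At a positive level the point \<open>x = 0\<close> is no solution, so the equation can be transported to the open
  interval, where both branches of the profile are covered.
\<close>

lemma card_F_level_set:
  assumes "0 < k" "0 < c"
  shows "card {x. 0 \<le> x \<and> F N k x = c} = card {u \<in> {0<..<1}. profile N u = c}"
proof -
  have "F N k 0 = 0" by (simp add: F_def)
  then have pos: "0 < x" if "0 \<le> x" "F N k x = c" for x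
    using that assms by (cases "x = 0") auto
  have "saturation k ` {x \<in> {0<..}. F N k x = c} = {u \<in> {0<..<1}. profile N u = c}"
  proof -
    have "saturation k ` {x \<in> {0<..}. F N k x = c}
        = {u \<in> saturation k ` {0<..}. profile N u = c}"
      using F_eq_profile[OF assms(1)] by auto
    then show ?thesis
      using bij_betw_imp_surj_on[OF bij_betw_saturation[OF assms(1)]] by simp
  qed
  moreover have "inj_on (saturation k) {x \<in> {0<..}. F N k x = c}"
    using bij_betw_imp_inj_on[OF bij_betw_saturation[OF assms(1)]] by (rule inj_on_subset) auto
  ultimately have "card {u \<in> {0<..<1}. profile N u = c} = card {x \<in> {0<..}. F N k x = c}"
    by (metis card_image)
  moreover have "{x \<in> {0<..}. F N k x = c} = {x. 0 \<le> x \<and> F N k x = c}"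
    using pos by auto
  ultimately show ?thesis by simp
qed

lemma alpha_star_eqI:
  assumes "0 < x0" "\<And>x. 0 < x \<Longrightarrow> F N k x \<le> F N k x0"
  shows "alpha_star r N k = r * F N k x0"
proof -
  have "(GREATEST m. m \<in> F N k ` {0<..}) = F N k x0"
    by (rule Greatest_equality) (use assms in auto)
  then show ?thesis by (simp add: alpha_star_def)
qed

theorem proposition2:
  fixes r k :: real and N :: nat
  assumes "r > 0" and "k > 0"
  shows "(\<exists>x0>0. \<forall>x>0. F N k x \<le> F N k x0) \<and>
         (\<forall>\<alpha>. 0 < \<alpha> \<and> \<alpha> < alpha_star r N k \<longrightarrow>
            card {x::real. x \<ge> 0 \<and> \<alpha> / r - F N k x = 0} = 2)"
proof (cases "N = 0")
  case True
  have F0: "F N k x = 0" if "0 < x" for x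
    using that F_eq_profile[OF assms(2), of x N] True by (simp add: profile_def)
  then have "alpha_star r N k = 0"
    using alpha_star_eqI[of 1 N k r] by simp
  with F0 show ?thesis by (auto intro!: exI[of _ 1])
next
  case False
  then obtain m where m: "0 < m" "m < 1"
    and inc: "strict_mono_on {0..m} (profile N)" and dec: "strict_antimono_on {m..1} (profile N)"
    using profile_unimodal by blast
  have surj: "saturation k ` {0<..} = {0<..<1}"
    using bij_betw_imp_surj_on[OF bij_betw_saturation[OF assms(2)]] .
  with m obtain x0 where x0: "0 < x0" "saturation k x0 = m"
    by (metis (no_types, lifting) greaterThanLessThan_iff greaterThan_iff imageE)
  have le_m: "profile N u \<le> profile N m" if "u \<in> {0<..<1}" for u
    using that m monotone_onD[OF inc, of u m] monotone_onD[OF dec, of m u]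
    by (cases u m rule: linorder_cases) auto
  have max: "F N k x \<le> F N k x0" if "0 < x" for x
  proof -
    have "saturation k x \<in> {0<..<1}" using that surj by blast
    then show ?thesis using that x0 le_m by (simp add: F_eq_profile[OF assms(2)])
  qed
  have "card {x. 0 \<le> x \<and> \<alpha> / r - F N k x = 0} = 2" if "0 < \<alpha>" "\<alpha> < alpha_star r N k" for \<alpha>
  proof -
    have "\<alpha> < r * F N k x0"
      using that alpha_star_eqI[OF x0(1) max] by simp
    then have c: "0 < \<alpha> / r" "\<alpha> / r < profile N m"
      using that assms x0 F_eq_profile[of k x0 N] by (auto simp: field_simps)
    have "continuous_on {0..1} (profile N)"
      unfolding profile_def by (intro continuous_intros)
    then have "card {u \<in> {0<..<1}. profile N u = \<alpha> / r} = 2"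
      using c m inc dec by (intro card_level_set_unimodal[where m = m]) (auto simp: profile_0 profile_1)
    moreover have "{x. 0 \<le> x \<and> \<alpha> / r - F N k x = 0} = {x. 0 \<le> x \<and> F N k x = \<alpha> / r}"
      by auto
    ultimately show ?thesis
      using card_F_level_set[OF assms(2) c(1)] by simp
  qed
  with max x0 show ?thesis by blast
qed

end
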